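(* Let $\Omega$ be an infinite set and let $f$ and $g$ be partial-bijections of $\Omega$ with $\operatorname{ind}(f) = \operatorname{ind}(g)$. Then there exist permutations $\lambda$ and $\rho$ of $\Omega$ such that $\lambda \circ f$ is almost equal to $g$ and $g$ is almost equal to $f \circ \rho$.
   Context: Let $\Omega$ be an infinite set. For $C \subseteq \Omega$ write $C' = \Omega \setminus C$ and $|C|$ for its cardinality. A partial-bijection of $\Omega$ is a bijection $f : A_f \to B_f$ where $A_f, B_f \subseteq \Omega$ are cofinite subsets. The index of $f$ is $\operatorname{ind}(f) = |A_f'| - |B_f'| \in \mathbb{Z}$. A permutation of $\Omega$ (a bijection $\Omega \to \Omega$) is regarded as a partial-bijection with domain and codomain $\Omega$. For partial-bijections $f : A_f \to B_f$ and $g : A_g \to B_g$, the composite $g \circ f$ is the partial-bijection with domain $f^{-1}(B_f \cap A_g)$ (preimage under $f$), codomain $g(B_f \cap A_g)$, and rule $(g\circ f)(\omega) = g(f(\omega))$. Two partial-bijections $f$ and $g$ are almost equal precisely when they agree on some cofinite subset of $\Omega$ contained in $A_f \cap A_g$. *)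

theory Defs
  imports Main
begin

text \<open>
  A partial-bijection \<open>A \<rightarrow> B\<close> of \<open>\<Omega>\<close> is a map \<open>f\<close> with \<open>dom f = A\<close> and \<open>ran f = B\<close>: a map
  carries no further data, so two partial-bijections are equal iff they have the same
  domain, codomain and rule. Cofinite means cofinite in \<open>\<Omega>\<close>.
\<close>

definition cofinite_in :: "'a set \<Rightarrow> 'a set \<Rightarrow> bool" where
  "cofinite_in \<Omega> C \<longleftrightarrow> C \<subseteq> \<Omega> \<and> finite (\<Omega> - C)"

definition partial_bijection :: "'a set \<Rightarrow> ('a \<rightharpoonup> 'a) \<Rightarrow> bool" where
  "partial_bijection \<Omega> f \<longleftrightarrow>
     cofinite_in \<Omega> (dom f) \<and> cofinite_in \<Omega> (ran f) \<and> inj_on f (dom f)"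

definition ind :: "'a set \<Rightarrow> ('a \<rightharpoonup> 'a) \<Rightarrow> int" where
  "ind \<Omega> f = int (card (\<Omega> - dom f)) - int (card (\<Omega> - ran f))"

text \<open>A permutation \<open>p\<close> of \<open>\<Omega>\<close> is a function with \<open>bij_betw p \<Omega> \<Omega>\<close>; its values outside \<open>\<Omega>\<close>
  are discarded when it is regarded as a partial-bijection.\<close>

definition perm_map :: "'a set \<Rightarrow> ('a \<Rightarrow> 'a) \<Rightarrow> ('a \<rightharpoonup> 'a)" where
  "perm_map \<Omega> p = (\<lambda>x. if x \<in> \<Omega> then Some (p x) else None)"

definition almost_equal :: "'a set \<Rightarrow> ('a \<rightharpoonup> 'a) \<Rightarrow> ('a \<rightharpoonup> 'a) \<Rightarrow> bool" where
  "almost_equal \<Omega> f g \<longleftrightarrow>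
     (\<exists>C. cofinite_in \<Omega> C \<and> C \<subseteq> dom f \<inter> dom g \<and> (\<forall>x\<in>C. f x = g x))"

lemma dom_perm_map: "dom (perm_map \<Omega> p) = \<Omega>"
  by (auto simp: perm_map_def dom_def)

lemma ran_perm_map: "bij_betw p \<Omega> \<Omega> \<Longrightarrow> ran (perm_map \<Omega> p) = \<Omega>"
  by (force simp: perm_map_def ran_def bij_betw_def split: if_splits)

lemma partial_bijection_perm_map:
  assumes "bij_betw p \<Omega> \<Omega>"
  shows "partial_bijection \<Omega> (perm_map \<Omega> p)"
proof -
  have "inj_on (perm_map \<Omega> p) \<Omega>"
    using assms by (auto simp: perm_map_def bij_betw_def inj_on_def)
  then show ?thesis
    using assms by (simp add: partial_bijection_def cofinite_in_def dom_perm_map ran_perm_map)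
qed

text \<open>The composite of partial-bijections is \<open>g \<circ>\<^sub>m f\<close>: its domain is the preimage of
  \<open>ran f \<inter> dom g\<close> under \<open>f\<close>, and its codomain is the image of that set under \<open>g\<close>.\<close>

lemma dom_map_comp: "dom (g \<circ>\<^sub>m f) = {x \<in> dom f. the (f x) \<in> ran f \<inter> dom g}"
  by (auto simp: map_comp_def dom_def ran_def split: option.splits)

lemma ran_map_comp: "ran (g \<circ>\<^sub>m f) = (\<lambda>y. the (g y)) ` (ran f \<inter> dom g)"
  by (force simp: map_comp_def dom_def ran_def image_iff split: option.splits)

lemma map_comp_apply:
  assumes "x \<in> dom (g \<circ>\<^sub>m f)"
  shows "the ((g \<circ>\<^sub>m f) x) = the (g (the (f x)))"
  using assms by (auto simp: map_comp_def dom_def split: option.splits)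

end

theory Submission
  imports Defs
begin

text \<open>
  Restricting a partial-bijection \<open>f\<close> to a cofinite set \<open>A \<subseteq> dom f\<close> does not change
  its index, so \<open>A\<close> and \<open>f(A)\<close> determine the difference of the sizes of their complements.
  Hence \<open>g \<circ> f\<^sup>-\<^sup>1\<close> maps \<open>f(A)\<close>, where \<open>A = dom f \<inter> dom g\<close>, bijectively onto
  \<open>g(A)\<close>, and \<open>f\<^sup>-\<^sup>1 \<circ> g\<close> maps \<open>g\<^sup>-\<^sup>1(D)\<close>, where \<open>D = ran f \<inter> ran g\<close>,
  bijectively onto \<open>f\<^sup>-\<^sup>1(D)\<close>, in both cases between sets whose complements are finite of
  the same size. Both maps therefore extend to permutations of \<open>\<Omega>\<close>.
\<close>

lemma cofinite_in_Int:
  "cofinite_in \<Omega> A \<Longrightarrow> cofinite_in \<Omega> B \<Longrightarrow> cofinite_in \<Omega> (A \<inter> B)"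
  by (auto simp: cofinite_in_def Diff_Int)

text \<open>The complements of \<open>A\<close> and \<open>B\<close> are finite of equal size, so
  some bijection \<open>k\<close> joins them; gluing \<open>h\<close> and \<open>k\<close> gives the
  permutation.\<close>

lemma bij_betw_extend_cofinite:
  assumes h: "bij_betw h A B"
    and A: "cofinite_in \<Omega> A" and B: "cofinite_in \<Omega> B"
    and card: "card (\<Omega> - A) = card (\<Omega> - B)"
  obtains p where "bij_betw p \<Omega> \<Omega>" "\<And>x. x \<in> A \<Longrightarrow> p x = h x"
proof -
  obtain k where k: "bij_betw k (\<Omega> - A) (\<Omega> - B)"
    using A B card finite_same_card_bij unfolding cofinite_in_def by blast
  define p where "p x = (if x \<in> A then h x else k x)" for x
  have "bij_betw p A B"
    using h by (rule bij_betw_cong[THEN iffD1, rotated]) (simp add: p_def)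
  moreover have "bij_betw p (\<Omega> - A) (\<Omega> - B)"
    using k by (rule bij_betw_cong[THEN iffD1, rotated]) (simp add: p_def)
  ultimately have "bij_betw p (A \<union> (\<Omega> - A)) (B \<union> (\<Omega> - B))"
    by (rule bij_betw_combine) auto
  moreover have "A \<union> (\<Omega> - A) = \<Omega>" "B \<union> (\<Omega> - B) = \<Omega>"
    using A B by (auto simp: cofinite_in_def)
  ultimately show thesis
    using that by (simp add: p_def)
qed

lemma bij_betw_the_dom_ran:
  "inj_on f (dom f) \<Longrightarrow> bij_betw (the \<circ> f) (dom f) (ran f)"
  by (force simp: bij_betw_def inj_on_def dom_def ran_def image_iff)

text \<open>By injectivity, the points that \<open>dom f\<close> loses when cut down to
  \<open>A\<close> correspond one to one to those that \<open>ran f\<close> loses. Both terms of the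
  index therefore grow by the same finite number.\<close>

lemma
  assumes f: "partial_bijection \<Omega> f" and A: "cofinite_in \<Omega> A" "A \<subseteq> dom f"
  shows cofinite_in_image: "cofinite_in \<Omega> ((the \<circ> f) ` A)"
    and ind_restrict:
      "ind \<Omega> f = int (card (\<Omega> - A)) - int (card (\<Omega> - (the \<circ> f) ` A))"
proof -
  let ?F = "the \<circ> f"
  have dom: "dom f \<subseteq> \<Omega>" "finite (\<Omega> - dom f)" and ran: "ran f \<subseteq> \<Omega>" "finite (\<Omega> - ran f)"
    and bij: "bij_betw ?F (dom f) (ran f)"
    using f bij_betw_the_dom_ran by (auto simp: partial_bijection_def cofinite_in_def)
  have fin: "finite (dom f - A)"
    using A dom by (auto simp: cofinite_in_def intro: finite_subset[of _ "\<Omega> - A"])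
  have bijd: "bij_betw ?F (dom f - A) (ran f - ?F ` A)"
    using bij A(2) inj_on_image_set_diff[of ?F "dom f" "dom f" A]
    by (metis Diff_subset bij_betw_def inj_on_subset subset_refl)
  have sub: "?F ` A \<subseteq> ran f"
    using bij A(2) unfolding bij_betw_def by (metis image_mono)
  have "\<Omega> - ?F ` A = (\<Omega> - ran f) \<union> (ran f - ?F ` A)" "\<Omega> - A = (\<Omega> - dom f) \<union> (dom f - A)"
    using sub A(2) dom ran by auto
  moreover have fin': "finite (ran f - ?F ` A)"
    using fin bijd bij_betw_finite by blast
  moreover have "card (ran f - ?F ` A) = card (dom f - A)"
    using bijd bij_betw_same_card by metis
  moreover have "card ((\<Omega> - ran f) \<union> (ran f - ?F ` A)) = card (\<Omega> - ran f) + card (ran f - ?F ` A)"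
    using ran fin' by (intro card_Un_disjoint) auto
  moreover have "card ((\<Omega> - dom f) \<union> (dom f - A)) = card (\<Omega> - dom f) + card (dom f - A)"
    using dom fin by (intro card_Un_disjoint) auto
  ultimately show "cofinite_in \<Omega> (?F ` A)"
    and "ind \<Omega> f = int (card (\<Omega> - A)) - int (card (\<Omega> - ?F ` A))"
    using sub ran by (auto simp: cofinite_in_def ind_def)
qed

text \<open>This lets a restriction be prescribed by its image instead of its domain. Points of
  \<open>dom f\<close> outside the preimage of \<open>D\<close> map injectively into the finite set
  \<open>\<Omega> - D\<close>, so only finitely many are lost.\<close>

lemma partial_bijection_preimage:
  assumes f: "partial_bijection \<Omega> f" and D: "cofinite_in \<Omega> D" "D \<subseteq> ran f"
  obtains A where "cofinite_in \<Omega> A" "A \<subseteq> dom f" "(the \<circ> f) ` A = D"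
proof
  let ?F = "the \<circ> f"
  let ?A = "{x \<in> dom f. ?F x \<in> D}"
  have dom: "dom f \<subseteq> \<Omega>" "finite (\<Omega> - dom f)" and ran: "ran f \<subseteq> \<Omega>"
    and bij: "bij_betw ?F (dom f) (ran f)"
    using f bij_betw_the_dom_ran by (auto simp: partial_bijection_def cofinite_in_def)
  have "?F ` (dom f - ?A) \<subseteq> \<Omega> - D"
    using bij ran by (auto simp: bij_betw_def)
  then have "finite (dom f - ?A)"
    using D(1) bij unfolding cofinite_in_def bij_betw_def
    by (meson Diff_subset finite_imageD finite_subset inj_on_subset)
  moreover have "\<Omega> - ?A \<subseteq> (\<Omega> - dom f) \<union> (dom f - ?A)"
    by auto
  ultimately show "cofinite_in \<Omega> ?A"
    using dom unfolding cofinite_in_def by (auto intro: finite_subset)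
  show "?A \<subseteq> dom f"
    by auto
  show "?F ` ?A = D"
  proof
    show "D \<subseteq> ?F ` ?A"
    proof
      fix y assume "y \<in> D"
      moreover from this obtain x where "x \<in> dom f" "y = ?F x"
        using bij D(2) unfolding bij_betw_def by (metis image_iff subsetD)
      ultimately show "y \<in> ?F ` ?A"
        by simp
    qed
  qed auto
qed

theorem theorem7:
  fixes \<Omega> :: "'a set" and f g :: "'a \<rightharpoonup> 'a"
  assumes "infinite \<Omega>"
    and "partial_bijection \<Omega> f"
    and "partial_bijection \<Omega> g"
    and "ind \<Omega> f = ind \<Omega> g"
  shows "\<exists>l r. bij_betw l \<Omega> \<Omega> \<and> bij_betw r \<Omega> \<Omega> \<and>
           almost_equal \<Omega> (perm_map \<Omega> l \<circ>\<^sub>m f) g \<and>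
           almost_equal \<Omega> g (f \<circ>\<^sub>m perm_map \<Omega> r)"
proof -
  note f = assms(2) and g = assms(3)
  let ?F = "the \<circ> f" and ?G = "the \<circ> g"
  have injF: "inj_on ?F (dom f)" and injG: "inj_on ?G (dom g)"
    using f g bij_betw_the_dom_ran by (auto simp: partial_bijection_def bij_betw_def)
  have bij: "bij_betw ?F A (?F ` A)" if "A \<subseteq> dom f" for A
    using that injF inj_on_subset by (auto simp: bij_betw_def)
  have bij': "bij_betw ?G A (?G ` A)" if "A \<subseteq> dom g" for A
    using that injG inj_on_subset by (auto simp: bij_betw_def)

  define A where "A = dom f \<inter> dom g"
  have A: "cofinite_in \<Omega> A" "A \<subseteq> dom f" "A \<subseteq> dom g"
    using f g by (auto simp: A_def partial_bijection_def intro: cofinite_in_Int)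
  have "bij_betw (?G \<circ> the_inv_into A ?F) (?F ` A) (?G ` A)"
    using bij_betw_trans[OF bij_betw_the_inv_into bij'] bij A by blast
  \<comment> \<open>Both maps are restricted to the same domain \<open>A\<close>, so the first terms
    of the two index formulas cancel.\<close>
  moreover have "card (\<Omega> - ?F ` A) = card (\<Omega> - ?G ` A)"
    using ind_restrict[OF f A(1,2)] ind_restrict[OF g A(1,3)] assms(4) by simp
  ultimately obtain l where l: "bij_betw l \<Omega> \<Omega>"
    and l_eq: "\<And>y. y \<in> ?F ` A \<Longrightarrow> l y = (?G \<circ> the_inv_into A ?F) y"
    using bij_betw_extend_cofinite cofinite_in_image[OF f A(1,2)] cofinite_in_image[OF g A(1,3)]
    by metis
  have "(perm_map \<Omega> l \<circ>\<^sub>m f) x = g x" if x: "x \<in> A" for x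
  proof -
    obtain y z where yz: "f x = Some y" "g x = Some z"
      using A x by blast
    have "y \<in> \<Omega>"
      using f yz by (auto simp: partial_bijection_def cofinite_in_def ran_def)
    moreover have "the_inv_into A ?F y = x"
      using the_inv_into_f_f[OF inj_on_subset[OF injF A(2)] x] yz by simp
    moreover have "y \<in> ?F ` A"
      using x yz by (force simp: image_iff)
    ultimately show ?thesis
      using l_eq yz by (simp add: perm_map_def)
  qed
  \<comment> \<open>As \<open>g\<close> is defined on \<open>A\<close>, agreement with
    \<open>g\<close> forces the composite to be defined there too.\<close>
  moreover from this have "A \<subseteq> dom (perm_map \<Omega> l \<circ>\<^sub>m f)"
    using A(3) by (auto simp: domIff)
  ultimately have left: "almost_equal \<Omega> (perm_map \<Omega> l \<circ>\<^sub>m f) g"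
    using A unfolding almost_equal_def by blast

  \<comment> \<open>The permutation \<open>r\<close> acts before \<open>f\<close>, so it must match
    points of \<open>dom g\<close> and \<open>dom f\<close> having the same value; hence a common
    image is fixed, not a common domain.\<close>
  define D where "D = ran f \<inter> ran g"
  have D: "cofinite_in \<Omega> D" "D \<subseteq> ran f" "D \<subseteq> ran g"
    using f g by (auto simp: D_def partial_bijection_def intro: cofinite_in_Int)
  obtain P where P: "cofinite_in \<Omega> P" "P \<subseteq> dom f" "?F ` P = D"
    using partial_bijection_preimage[OF f D(1,2)] .
  obtain Q where Q: "cofinite_in \<Omega> Q" "Q \<subseteq> dom g" "?G ` Q = D"
    using partial_bijection_preimage[OF g D(1,3)] .
  have "bij_betw (the_inv_into P ?F \<circ> ?G) Q P"
    using bij_betw_trans[OF bij' bij_betw_the_inv_into] bij P Q by metis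
  \<comment> \<open>Now the images of \<open>P\<close> and \<open>Q\<close> coincide, so the second
    terms of the index formulas cancel.\<close>
  moreover have "card (\<Omega> - Q) = card (\<Omega> - P)"
    using ind_restrict[OF f P(1,2)] ind_restrict[OF g Q(1,2)] assms(4) P(3) Q(3) by simp
  ultimately obtain r where r: "bij_betw r \<Omega> \<Omega>"
    and r_eq: "\<And>x. x \<in> Q \<Longrightarrow> r x = (the_inv_into P ?F \<circ> ?G) x"
    using bij_betw_extend_cofinite P(1) Q(1) by metis
  have "g x = (f \<circ>\<^sub>m perm_map \<Omega> r) x" if x: "x \<in> Q" for x
  proof -
    have "?G x \<in> ?F ` P"
      using x P(3) Q(3) by auto
    \<comment> \<open>By construction \<open>r x\<close> is the unique point of \<open>P\<close>
      that \<open>f\<close> sends to the value of \<open>g\<close> at \<open>x\<close>.\<close>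
    then have "?F (r x) = ?G x" "r x \<in> P"
      using f_the_inv_into_f[OF inj_on_subset[OF injF P(2)]]
        the_inv_into_into[OF inj_on_subset[OF injF P(2)] _ subset_refl] r_eq[OF x] by auto
    moreover have "x \<in> \<Omega>" "x \<in> dom g" "r x \<in> dom f"
      using Q x P(2) \<open>r x \<in> P\<close> by (auto simp: cofinite_in_def)
    ultimately show ?thesis
      by (auto simp: perm_map_def)
  qed
  moreover from this have "Q \<subseteq> dom (f \<circ>\<^sub>m perm_map \<Omega> r)"
    using Q(2) by (auto simp: domIff)
  ultimately have "almost_equal \<Omega> g (f \<circ>\<^sub>m perm_map \<Omega> r)"
    using Q unfolding almost_equal_def by blast
  with l r left show ?thesis
    by blast
qed

end
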